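(* For every positive integer $k$ and every Boolean symmetric function $F:\{0,1\}^k\to\mathbb{C}$, there is a planar gadget with signature $F$ that has $O(k)$ vertices and in which every vertex is assigned a Boolean function of arity no more than $5$.
   Context: $\mathbb{C}$ denotes the algebraic complex numbers. A Boolean function of arity $k$ is a map $\{0,1\}^k\to\mathbb{C}$; it is symmetric if its value is invariant under all permutations of its inputs, i.e. depends only on the Hamming weight of the input. A gadget is a pair $(G,\pi)$ where $G=(V,E\cup X)$ is a graph whose edges split into the set $E$ of ordinary edges (both endpoints in $V$) and the set $X$ of dangling edges (one endpoint in $V$, the other end dangling), and $\pi$ assigns to every vertex $v\in V$ a Boolean function $F_v$ of arity equal to the degree of $v$ (dangling edges included), together with a linear order on the set $N(v)$ of edges incident to $v$. With $k=|X|$, the signature of the gadget is the function $$\Gamma(y_1,\dots,y_k)=\sum_{\sigma:E\to\{0,1\}}\ \prod_{v\in V}F_v\big(\hat\sigma|_{N(v)}\big),$$ where $(y_1,\dots,y_k)\in\{0,1\}^k$ is the assignment to $X$ and $\hat\sigma$ is the extension of $\sigma$ to $E\cup X$ by $(y_1,\dots,y_k)$. The gadget is planar if it can be drawn in the plane without crossings with all dangling edges lying in the outer face. The constant in $O(\cdot)$ is absolute. *)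

theory Defs
  imports
    "HOL-Analysis.Analysis"
    "HOL-Computational_Algebra.Polynomial"
    "HOL-Combinatorics.Permutations"
begin

(* A Boolean function of arity k is a function on bool lists of which only the values on
   lists of length k matter.  Values are required to be algebraic complex numbers. *)

definition algebraic_valued :: "nat \<Rightarrow> (bool list \<Rightarrow> complex) \<Rightarrow> bool" where
  "algebraic_valued k F \<longleftrightarrow> (\<forall>xs. length xs = k \<longrightarrow> algebraic (F xs))"

definition symmetric_fun :: "nat \<Rightarrow> (bool list \<Rightarrow> complex) \<Rightarrow> bool" where
  "symmetric_fun k F \<longleftrightarrow>
     (\<forall>p xs. p permutes {..<k} \<longrightarrow> length xs = k \<longrightarrow> F (permute_list p xs) = F xs)"

(* The list of dangling edges also fixes which dangling edge carries which argument of the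
   signature.  The set ends e consists of the endpoints of e that are vertices: two for an
   ordinary edge, one for a dangling edge.  The list nbr_order v is the linear order on the
   edges incident to v. *)

record ('v, 'e) gadget =
  verts :: "'v set"
  edges :: "'e set"
  dangling :: "'e list"
  ends :: "'e \<Rightarrow> 'v set"
  nbr_order :: "'v \<Rightarrow> 'e list"
  vfun :: "'v \<Rightarrow> bool list \<Rightarrow> complex"

definition incident :: "('v, 'e) gadget \<Rightarrow> 'v \<Rightarrow> 'e set" where
  "incident G v = {e \<in> edges G \<union> set (dangling G). v \<in> ends G e}"

definition degree_at :: "('v, 'e) gadget \<Rightarrow> 'v \<Rightarrow> nat" where
  "degree_at G v = card (incident G v)"

(* The graph is simple: no loops (card = 2) and no parallel ordinary edges (inj_on).
   Several dangling edges may share their vertex. *)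

definition is_gadget :: "('v, 'e) gadget \<Rightarrow> bool" where
  "is_gadget G \<longleftrightarrow>
     finite (verts G) \<and> finite (edges G) \<and>
     distinct (dangling G) \<and> edges G \<inter> set (dangling G) = {} \<and>
     (\<forall>e\<in>edges G. ends G e \<subseteq> verts G \<and> card (ends G e) = 2) \<and>
     inj_on (ends G) (edges G) \<and>
     (\<forall>x\<in>set (dangling G). \<exists>v\<in>verts G. ends G x = {v}) \<and>
     (\<forall>v\<in>verts G. distinct (nbr_order G v) \<and> set (nbr_order G v) = incident G v) \<and>
     (\<forall>v\<in>verts G. algebraic_valued (degree_at G v) (vfun G v))"

definition extend_assignment ::
    "('v, 'e) gadget \<Rightarrow> bool list \<Rightarrow> ('e \<Rightarrow> bool) \<Rightarrow> 'e \<Rightarrow> bool" where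
  "extend_assignment G ys \<sigma> e =
     (if e \<in> edges G then \<sigma> e else the (map_of (zip (dangling G) ys) e))"

definition signature :: "('v, 'e) gadget \<Rightarrow> bool list \<Rightarrow> complex" where
  "signature G ys =
     (\<Sum>\<sigma> \<in> edges G \<rightarrow>\<^sub>E (UNIV :: bool set).
        \<Prod>v\<in>verts G. vfun G v (map (extend_assignment G ys \<sigma>) (nbr_order G v)))"

definition has_signature :: "('v, 'e) gadget \<Rightarrow> nat \<Rightarrow> (bool list \<Rightarrow> complex) \<Rightarrow> bool" where
  "has_signature G k F \<longleftrightarrow>
     length (dangling G) = k \<and> (\<forall>ys. length ys = k \<longrightarrow> signature G ys = F ys)"

(* Crossing-free drawings: pos places the vertices and c e is the arc representing the edge e;
   the arc of a dangling edge runs from its vertex to a free end.  The intersection of a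
   dangling edge with the vertices is just its vertex, so the free end is not a vertex point. *)

definition plane_drawing ::
    "('v, 'e) gadget \<Rightarrow> ('v \<Rightarrow> real \<times> real) \<Rightarrow> ('e \<Rightarrow> real \<Rightarrow> real \<times> real) \<Rightarrow> bool" where
  "plane_drawing G pos c \<longleftrightarrow>
     inj_on pos (verts G) \<and>
     (\<forall>e \<in> edges G \<union> set (dangling G).
        arc (c e) \<and> path_image (c e) \<inter> pos ` verts G = pos ` ends G e) \<and>
     (\<forall>e \<in> edges G. {pathstart (c e), pathfinish (c e)} = pos ` ends G e) \<and>
     (\<forall>x \<in> set (dangling G). {pathstart (c x)} = pos ` ends G x) \<and>
     (\<forall>e \<in> edges G \<union> set (dangling G). \<forall>e' \<in> edges G \<union> set (dangling G). e \<noteq> e' \<longrightarrow>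
        path_image (c e) \<inter> path_image (c e') \<subseteq> pos ` (ends G e \<inter> ends G e'))"

definition drawn_points ::
    "('v, 'e) gadget \<Rightarrow> ('v \<Rightarrow> real \<times> real) \<Rightarrow> ('e \<Rightarrow> real \<Rightarrow> real \<times> real) \<Rightarrow> (real \<times> real) set"
  where
  "drawn_points G pos c = pos ` verts G \<union> (\<Union>e\<in>edges G. path_image (c e))"

(* The points drawn for (V, E) form a compact subset of the plane, so outside of it is the
   outer face: the unique unbounded component of its complement. *)

definition planar_gadget :: "('v, 'e) gadget \<Rightarrow> bool" where
  "planar_gadget G \<longleftrightarrow>
     is_gadget G \<and>
     (\<exists>pos c. plane_drawing G pos c \<and>
        (\<forall>x \<in> set (dangling G).
           path_image (c x) - pos ` ends G x \<subseteq> outside (drawn_points G pos c)))"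

end

(* A symmetric function depends on the number w of ones only.  Rows of full adders (arity 5),
   halving in length from row to row, compute the binary digits of w: row h adds the inputs of
   significance 2^(h-1) modulo 2 from left to right and sends its carries up.  Each row is
   continued to the right by demultiplexers (arity 5), of which there are twice as many in each
   lower row; the digit computed by the adders runs along the row, and the enabling signal
   from above goes to the left or the right child according to it.  So exactly one of the right
   leaves is enabled, the one numbered w, and it contributes the value of the function.  The
   circuit is deterministic, hence only one assignment contributes to the signature.  Adders
   and demultiplexers together form a complete binary tree with horizontal paths, which is
   planar. *)

theory Submission
  imports Defs
begin

section \<open>Transport of gadgets along injections into the natural numbers\<close>

section \<open>Relabelling by natural numbers\<close>

text \<open>The network is built on pairs and a datatype of edges, while the goal asks for labels in
  \<open>nat\<close>. Only labels in the range of \<open>to_nat\<close> ever matter, and there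
  \<open>from_nat\<close> inverts it.\<close>

definition relabel :: "('v::countable, 'e::countable) gadget \<Rightarrow> (nat, nat) gadget" where
  "relabel G = \<lparr>verts = to_nat ` verts G, edges = to_nat ` edges G,
     dangling = map to_nat (dangling G),
     ends = (\<lambda>e. to_nat ` ends G (from_nat e)),
     nbr_order = (\<lambda>v. map to_nat (nbr_order G (from_nat v))),
     vfun = (\<lambda>v. vfun G (from_nat v))\<rparr>"

lemma relabel_simps [simp]:
  "verts (relabel G) = to_nat ` verts G"
  "edges (relabel G) = to_nat ` edges G"
  "dangling (relabel G) = map to_nat (dangling G)"
  "ends (relabel G) (to_nat e) = to_nat ` ends G e"
  "nbr_order (relabel G) (to_nat v) = map to_nat (nbr_order G v)"
  "vfun (relabel G) (to_nat v) = vfun G v"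
  by (simp_all add: relabel_def)

lemma incident_relabel [simp]: "incident (relabel G) (to_nat v) = to_nat ` incident G v"
  by (auto simp: incident_def)

lemma degree_relabel [simp]: "degree_at (relabel G) (to_nat v) = degree_at G v"
  unfolding degree_at_def incident_relabel by (rule card_image) simp

lemma is_gadget_relabel:
  assumes "is_gadget G"
  shows "is_gadget (relabel G)"
  using assms unfolding is_gadget_def
  by (auto simp: distinct_map card_image inj_on_def inj_image_eq_iff[OF inj_to_nat])

lemma map_of_zip_map_inj:
  assumes "inj f"
  shows "map_of (zip (map f xs) ys) (f x) = map_of (zip xs ys) x"
proof (induction xs arbitrary: ys)
  case (Cons a xs)
  then show ?case using assms by (cases ys) (auto dest: injD)
qed simp

text \<open>The restriction puts the pulled-back assignment into the extensional function space
  summed over in \<open>signature\<close>. It changes nothing, because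
  \<open>extend_assignment\<close> consults \<open>\<sigma>\<close> on ordinary edges only.\<close>

lemma extend_relabel:
  "extend_assignment (relabel G) ys \<sigma> (to_nat e) =
   extend_assignment G ys (\<lambda>e\<in>edges G. \<sigma> (to_nat e)) e"
  by (auto simp: extend_assignment_def map_of_zip_map_inj[OF inj_to_nat])

lemma signature_relabel: "signature (relabel G) ys = signature G ys"
  unfolding signature_def
proof (rule sum.reindex_bij_witness)
  let ?i = "\<lambda>\<sigma>. \<lambda>e\<in>to_nat ` edges G. \<sigma> (from_nat e)" and ?j = "\<lambda>\<sigma>. \<lambda>e\<in>edges G. \<sigma> (to_nat e)"
  fix \<sigma> :: "nat \<Rightarrow> bool"
  assume s: "\<sigma> \<in> edges (relabel G) \<rightarrow>\<^sub>E UNIV"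
  show "?i (?j \<sigma>) = \<sigma>" using s by (intro ext) (auto simp: PiE_def extensional_def)
  show "?j \<sigma> \<in> edges G \<rightarrow>\<^sub>E UNIV" by auto
  show "(\<Prod>v\<in>verts G. vfun G v (map (extend_assignment G ys (?j \<sigma>)) (nbr_order G v))) =
     (\<Prod>v\<in>verts (relabel G). vfun (relabel G) v
        (map (extend_assignment (relabel G) ys \<sigma>) (nbr_order (relabel G) v)))"
    by (simp add: prod.reindex extend_relabel o_def)
next
  let ?i = "\<lambda>\<sigma>. \<lambda>e\<in>to_nat ` edges G. \<sigma> (from_nat e)" and ?j = "\<lambda>\<sigma>. \<lambda>e\<in>edges G. \<sigma> (to_nat e)"
  fix \<sigma> :: "'b \<Rightarrow> bool"
  assume s: "\<sigma> \<in> edges G \<rightarrow>\<^sub>E UNIV"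
  show "?j (?i \<sigma>) = \<sigma>" using s by (intro ext) (auto simp: PiE_def extensional_def)
  show "?i \<sigma> \<in> edges (relabel G) \<rightarrow>\<^sub>E UNIV" by auto
qed

lemma planar_relabel:
  assumes "planar_gadget G"
  shows "planar_gadget (relabel G)"
proof -
  from assms obtain pos c where pl: "plane_drawing G pos c"
    and out: "\<forall>x \<in> set (dangling G).
      path_image (c x) - pos ` ends G x \<subseteq> outside (drawn_points G pos c)"
    unfolding planar_gadget_def by blast
  have im [simp]: "(\<lambda>v. pos (from_nat v)) ` to_nat ` A = pos ` A" for A
    by (simp add: image_image)
  have int [simp]: "to_nat ` A \<inter> to_nat ` B = to_nat ` (A \<inter> B)" for A B :: "'a set"
    by (simp add: image_Int)
  have "plane_drawing (relabel G) (\<lambda>v. pos (from_nat v)) (\<lambda>e. c (from_nat e))"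
    using pl unfolding plane_drawing_def relabel_simps set_map image_Un[symmetric] ball_simps
    by (simp add: inj_on_def)
  moreover have "drawn_points (relabel G) (\<lambda>v. pos (from_nat v)) (\<lambda>e. c (from_nat e)) =
      drawn_points G pos c"
    by (simp add: drawn_points_def)
  ultimately show ?thesis
    using assms out is_gadget_relabel unfolding planar_gadget_def
    by (intro conjI exI[of _ "\<lambda>v. pos (from_nat v)"] exI[of _ "\<lambda>e. c (from_nat e)"]) auto
qed

section \<open>Signatures in which a single assignment survives\<close>

section \<open>Deterministic networks\<close>

text \<open>Lets a vertex function be written with named edges instead of argument positions, so
  that the linear order at the vertex becomes irrelevant.\<close>

definition local_vfun :: "('e list) \<Rightarrow> (('e \<Rightarrow> bool) \<Rightarrow> 'a) \<Rightarrow> bool list \<Rightarrow> 'a" where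
  "local_vfun l Q xs = Q (\<lambda>e. the (map_of (zip l xs) e))"

lemma local_vfun_map:
  assumes "distinct l" and "\<And>a b. (\<And>e. e \<in> set l \<Longrightarrow> a e = b e) \<Longrightarrow> Q a = Q b"
  shows "local_vfun l Q (map a l) = Q a"
  unfolding local_vfun_def by (rule assms(2)) (simp add: map_of_zip_map)

text \<open>An assignment other than \<open>a0\<close> violates \<open>ok\<close> at some vertex,
  where the vertex function vanishes and kills the whole product. The sum collapses to the term of
  \<open>a0\<close>.\<close>

lemma signature_unique_assignment:
  assumes "is_gadget G"
    and vfun: "\<And>v a. v \<in> verts G \<Longrightarrow>
      vfun G v (map a (nbr_order G v)) = (if ok v a then wt v a else 0)"
    and ok: "\<And>v. v \<in> verts G \<Longrightarrow> ok v a0"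
    and unique: "\<And>a. (\<And>v. v \<in> verts G \<Longrightarrow> ok v a) \<Longrightarrow>
      (\<And>x. x \<in> set (dangling G) \<Longrightarrow> a x = a0 x) \<Longrightarrow> \<forall>e\<in>edges G. a e = a0 e"
    and ys: "ys = map a0 (dangling G)"
  shows "signature G ys = (\<Prod>v\<in>verts G. wt v a0)"
proof -
  let ?X = "extend_assignment G ys"
  let ?s = "restrict a0 (edges G)"
  have dang: "?X \<sigma> x = a0 x" if "x \<in> set (dangling G)" for \<sigma> x
    using assms(1) that unfolding extend_assignment_def is_gadget_def ys
    by (auto simp: map_of_zip_map)
  have Xs: "?X ?s e = a0 e" if "e \<in> edges G \<union> set (dangling G)" for e
    using that dang[of e] by (cases "e \<in> edges G") (simp_all add: extend_assignment_def)
  have "(\<Prod>v\<in>verts G. vfun G v (map (?X \<sigma>) (nbr_order G v))) = 0"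
    if s: "\<sigma> \<in> edges G \<rightarrow>\<^sub>E UNIV" "\<sigma> \<noteq> ?s" for \<sigma>
  proof -
    have "\<exists>v\<in>verts G. \<not> ok v (?X \<sigma>)"
    proof (rule ccontr)
      assume "\<not> ?thesis"
      \<comment> \<open>The extension agrees with \<open>a0\<close> on the dangling edges by the
        choice of \<open>ys\<close>, so \<open>unique\<close> applies to it.\<close>
      then have "\<forall>e\<in>edges G. ?X \<sigma> e = a0 e" using unique[of "?X \<sigma>"] dang by blast
      then have "\<sigma> = ?s" using s(1) by (intro ext) (auto simp: extend_assignment_def PiE_def extensional_def)
      then show False using s by simp
    qed
    then show ?thesis using assms(1) vfun by (auto simp: is_gadget_def intro!: prod_zero)
  qed
  moreover have "vfun G v (map (?X ?s) (nbr_order G v)) = wt v a0" if v: "v \<in> verts G" for v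
  proof -
    have "map (?X ?s) (nbr_order G v) = map a0 (nbr_order G v)"
      using assms(1) Xs v by (auto simp: is_gadget_def incident_def)
    then show ?thesis using vfun[OF v, of a0] ok[OF v] by (simp only: if_True)
  qed
  then have "(\<Prod>v\<in>verts G. vfun G v (map (?X ?s) (nbr_order G v))) = (\<Prod>v\<in>verts G. wt v a0)"
    by (rule prod.cong[OF refl])
  moreover have "finite (edges G \<rightarrow>\<^sub>E (UNIV :: bool set))"
    using assms(1) by (auto simp: is_gadget_def intro: finite_PiE)
  ultimately show ?thesis unfolding signature_def
    by (subst sum.remove[of _ ?s]) auto
qed

section \<open>The tree of adders and demultiplexers, its size and its degrees\<close>

section \<open>The counting network\<close>

text \<open>Vertices are pairs of a height and a position in the row at that height.\<close>

datatype edge = Up nat nat | Hor nat nat | Dang nat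

instance edge :: countable
  by countable_datatype

fun edge_ends :: "edge \<Rightarrow> (nat \<times> nat) set" where
  "edge_ends (Up h i) = {(h, i), (Suc h, i div 2)}"
| "edge_ends (Hor h i) = {(h, i), (h, Suc i)}"
| "edge_ends (Dang i) = {(0, i)}"

text \<open>Row 0 has \<open>2 ^ m\<close> input leaves followed by \<open>2 ^ m\<close> output
  leaves. In rows 1 to \<open>m\<close> the left half are adders and the right half demultiplexers;
  row \<open>Suc m\<close> is the root.\<close>

definition net_verts :: "nat \<Rightarrow> (nat \<times> nat) set" where
  "net_verts m = (SIGMA h:{..Suc m}. {..<2 ^ (Suc m - h)})"

definition net_edges :: "nat \<Rightarrow> edge set" where
  "net_edges m = case_prod Up ` (SIGMA h:{..m}. {..<2 ^ (Suc m - h)}) \<union>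
     case_prod Hor ` (SIGMA h:{1..m}. {..<2 ^ (Suc m - h) - 1})"

definition net_incident :: "nat \<Rightarrow> nat \<Rightarrow> nat \<times> nat \<Rightarrow> edge set" where
  "net_incident m k v = {e \<in> net_edges m \<union> Dang ` {..<k}. v \<in> edge_ends e}"

text \<open>Any order will do, since \<open>local_vfun\<close> looks up bits by edge.\<close>

definition net_order :: "nat \<Rightarrow> nat \<Rightarrow> nat \<times> nat \<Rightarrow> edge list" where
  "net_order m k v = (SOME l. distinct l \<and> set l = net_incident m k v)"

text \<open>A missing left neighbour stands for the bit 0.  The root requires that the final carry is 0
  and enables the topmost demultiplexer.\<close>

definition node_ok :: "nat \<Rightarrow> nat \<Rightarrow> nat \<times> nat \<Rightarrow> (edge \<Rightarrow> bool) \<Rightarrow> bool" where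
  "node_ok m k = (\<lambda>(h, i) a.
     if h = 0 then i < 2 ^ m \<longrightarrow> a (Up 0 i) = (i < k \<and> a (Dang i))
     else if h = Suc m then \<not> a (Up m 0) \<and> a (Up m 1)
     else
       let l = (0 < i \<and> a (Hor h (i - 1)));
           c0 = a (Up (h - 1) (2 * i));
           c1 = a (Up (h - 1) (Suc (2 * i)))
       in if i < 2 ^ (m - h)
          then of_bool l + of_bool c0 + of_bool c1 =
               (of_bool (a (Hor h i)) + 2 * of_bool (a (Up h i)) :: nat)
          else (Suc i < 2 ^ (Suc m - h) \<longrightarrow> a (Hor h i) = l) \<and>
               c0 = (a (Up h i) \<and> \<not> l) \<and> c1 = (a (Up h i) \<and> l))"

definition node_weight ::
    "nat \<Rightarrow> (nat \<Rightarrow> complex) \<Rightarrow> nat \<times> nat \<Rightarrow> (edge \<Rightarrow> bool) \<Rightarrow> complex" where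
  "node_weight m f = (\<lambda>(h, i) a. if h = 0 \<and> 2 ^ m \<le> i \<and> a (Up 0 i) then f (i - 2 ^ m) else 1)"

definition node_fun ::
    "nat \<Rightarrow> nat \<Rightarrow> (nat \<Rightarrow> complex) \<Rightarrow> nat \<times> nat \<Rightarrow> (edge \<Rightarrow> bool) \<Rightarrow> complex" where
  "node_fun m k f v a = (if node_ok m k v a then node_weight m f v a else 0)"

definition net :: "nat \<Rightarrow> nat \<Rightarrow> (nat \<Rightarrow> complex) \<Rightarrow> (nat \<times> nat, edge) gadget" where
  "net m k f = \<lparr>verts = net_verts m, edges = net_edges m, dangling = map Dang [0..<k],
     ends = edge_ends, nbr_order = net_order m k,
     vfun = (\<lambda>v. local_vfun (net_order m k v) (node_fun m k f v))\<rparr>"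

lemma net_simps [simp]:
  "verts (net m k f) = net_verts m"
  "edges (net m k f) = net_edges m"
  "dangling (net m k f) = map Dang [0..<k]"
  "ends (net m k f) = edge_ends"
  "nbr_order (net m k f) = net_order m k"
  "vfun (net m k f) v = local_vfun (net_order m k v) (node_fun m k f v)"
  by (simp_all add: net_def)

lemma incident_net [simp]: "incident (net m k f) = net_incident m k"
  by (auto simp: incident_def net_incident_def fun_eq_iff)

lemma mem_net_verts [simp]:
  "(h, i) \<in> net_verts m \<longleftrightarrow> h \<le> Suc m \<and> i < 2 ^ (Suc m - h)"
  by (auto simp: net_verts_def)

lemma mem_net_edges [simp]:
  "Up h i \<in> net_edges m \<longleftrightarrow> h \<le> m \<and> i < 2 ^ (Suc m - h)"
  "Hor h i \<in> net_edges m \<longleftrightarrow> 0 < h \<and> h \<le> m \<and> Suc i < 2 ^ (Suc m - h)"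
  "Dang i \<notin> net_edges m"
  by (auto simp: net_edges_def image_iff)

lemma finite_net [simp]: "finite (net_verts m)" "finite (net_edges m)"
  by (auto simp: net_verts_def net_edges_def)

lemma net_order:
  "distinct (net_order m k v)" "set (net_order m k v) = net_incident m k v"
proof -
  have "finite (net_incident m k v)" by (simp add: net_incident_def)
  then have "\<exists>l. distinct l \<and> set l = net_incident m k v" using finite_distinct_list by metis
  from someI_ex[OF this] show "distinct (net_order m k v)"
    "set (net_order m k v) = net_incident m k v"
    by (simp_all add: net_order_def)
qed

text \<open>The guards in \<open>node_ok\<close> exclude missing neighbours, so the value at a
  vertex depends on incident edges only. This is the locality that \<open>local_vfun_map\<close>
  requires.\<close>

lemma node_fun_local:
  assumes "v \<in> net_verts m" and "k \<le> 2 ^ m"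
    and eq: "\<And>e. e \<in> net_incident m k v \<Longrightarrow> a e = b e"
  shows "node_fun m k f v a = node_fun m k f v b"
proof -
  obtain h i where v: "v = (h, i)" by fastforce
  have hi: "h \<le> Suc m" "i < 2 ^ (Suc m - h)" using assms(1) v by auto
  consider "h = 0" | "h = Suc m" | "0 < h" "h \<le> m" using hi by linarith
  then show ?thesis
  proof cases
    case 1
    have "a (Up 0 i) = b (Up 0 i)" using 1 hi v by (intro eq) (auto simp: net_incident_def)
    moreover have "a (Dang i) = b (Dang i)" if "i < k"
      using 1 that v by (intro eq) (auto simp: net_incident_def)
    ultimately show ?thesis using 1 v
      by (auto simp: node_fun_def node_ok_def node_weight_def)
  next
    case 2
    have "a (Up m 0) = b (Up m 0)" "a (Up m 1) = b (Up m 1)"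
      using 2 hi v by (auto intro!: eq simp: net_incident_def)
    then show ?thesis using 2 v
      by (auto simp: node_fun_def node_ok_def node_weight_def)
  next
    case 3
    define n :: nat where "n = 2 ^ (m - h)"
    have p: "2 ^ (Suc m - h) = 2 * n" "2 ^ (Suc m - (h - 1)) = 4 * n" "n > 0"
    proof -
      have "Suc m - h = Suc (m - h)" "Suc m - (h - 1) = Suc (Suc (m - h))" using 3 by auto
      then show "2 ^ (Suc m - h) = 2 * n" "2 ^ (Suc m - (h - 1)) = 4 * n" "n > 0"
        by (simp_all add: n_def)
    qed
    have i: "i < 2 * n" using hi p by simp
    have "a (Up h i) = b (Up h i)" "a (Up (h - 1) (2 * i)) = b (Up (h - 1) (2 * i))"
      "a (Up (h - 1) (Suc (2 * i))) = b (Up (h - 1) (Suc (2 * i)))"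
      using 3 i p v by (auto intro!: eq simp: net_incident_def)
    moreover have "a (Hor h i) = b (Hor h i)" if "Suc i < 2 * n"
      using 3 p v that by (intro eq) (auto simp: net_incident_def)
    moreover have "a (Hor h (i - 1)) = b (Hor h (i - 1))" if "0 < i"
      using 3 p v that i by (intro eq) (auto simp: net_incident_def)
    \<comment> \<open>Every adder has a right neighbour, so the edge carrying its sum bit
      exists.\<close>
    moreover have "Suc i < 2 * n" if "i < n" using that p by linarith
    ultimately have "node_ok m k v a = node_ok m k v b" using 3 v
      unfolding node_ok_def Let_def prod.case
      by (cases "0 < i"; cases "i < n"; cases "Suc i < 2 * n")
        (simp_all add: p(1) flip: n_def)
    then show ?thesis using 3 v by (simp add: node_fun_def node_weight_def)
  qed
qed

lemma net_vfun_map: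
  assumes "v \<in> net_verts m" and "k \<le> 2 ^ m"
  shows "vfun (net m k f) v (map a (net_order m k v)) = node_fun m k f v a"
  unfolding net_simps
proof (rule local_vfun_map[OF net_order(1)])
  fix a b :: "edge \<Rightarrow> bool"
  assume "\<And>e. e \<in> set (net_order m k v) \<Longrightarrow> a e = b e"
  then show "node_fun m k f v a = node_fun m k f v b"
    unfolding net_order(2) by (rule node_fun_local[OF assms])
qed

lemma is_gadget_net:
  assumes "k \<le> 2 ^ m" and "\<And>j. algebraic (f j)"
  shows "is_gadget (net m k f)"
proof -
  have ends: "edge_ends e \<subseteq> net_verts m \<and> card (edge_ends e) = 2" if "e \<in> net_edges m" for e
  proof (cases e)
    case (Up h i)
    then have "h \<le> m" "i < 2 ^ Suc (m - h)" using that by (auto simp: Suc_diff_le)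
    then have "i div 2 < 2 ^ (m - h)" by auto
    then show ?thesis using Up that by simp
  qed (use that in auto)
  moreover have "inj_on edge_ends (net_edges m)"
  proof (rule inj_onI)
    fix e e' assume "e \<in> net_edges m" "e' \<in> net_edges m" "edge_ends e = edge_ends e'"
    then show "e = e'" by (cases e; cases e') (auto simp: doubleton_eq_iff)
  qed
  moreover have "algebraic (node_fun m k f v a)" for v a
    using assms(2) by (auto simp: node_fun_def node_weight_def split: prod.split)
  ultimately show ?thesis
    using assms(1) unfolding is_gadget_def net_simps
    by (auto simp: net_order distinct_map inj_on_def algebraic_valued_def local_vfun_def
        intro: less_le_trans)
qed

text \<open>The rows have sizes \<open>2 ^ (m + 1)\<close>, ..., 2, 1, a geometric sum.\<close>

lemma card_net_verts: "card (net_verts m) < 4 * 2 ^ m"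
proof -
  have "card (net_verts m) = (\<Sum>h\<le>Suc m. 2 ^ (Suc m - h))"
    by (simp add: net_verts_def)
  also have "\<dots> = (\<Sum>h\<le>Suc m. 2 ^ h)"
    by (rule sum.reindex_bij_witness[of _ "\<lambda>h. Suc m - h" "\<lambda>h. Suc m - h"]) auto
  also have "\<dots> < 2 ^ Suc (Suc m)"
    by (induction m) auto
  finally show ?thesis by simp
qed

lemma degree_net: "degree_at (net m k f) v \<le> 5"
proof -
  obtain h i where v: "v = (h, i)" by fastforce
  \<comment> \<open>Parent, right and left neighbour, two children. At the border some entries are
    absent from the network or repeated (\<open>i - 1 = i\<close> for \<open>i = 0\<close>), so only
    an inclusion is claimed and the length bounds the degree.\<close>
  let ?l = "if h = 0 then [Up 0 i, Dang i] else
    [Up h i, Hor h i, Hor h (i - 1), Up (h - 1) (2 * i), Up (h - 1) (Suc (2 * i))]"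
  have "net_incident m k v \<subseteq> set ?l"
  proof
    fix e assume "e \<in> net_incident m k v"
    moreover have "j = 2 * (j div 2) \<or> j = Suc (2 * (j div 2))" for j :: nat by presburger
    ultimately show "e \<in> set ?l" using v
      by (cases e; cases h) (auto simp: net_incident_def)
  qed
  then have "card (net_incident m k v) \<le> card (set ?l)" by (rule card_mono[rotated]) simp
  also have "\<dots> \<le> length ?l" by (rule card_length)
  also have "\<dots> \<le> 5" by simp
  finally show ?thesis by (simp add: degree_at_def)
qed

section \<open>A straight-line drawing in the upper half-plane, with the inputs hanging below
  it\<close>

section \<open>The drawing\<close>

text \<open>Each vertex stands above the leftmost leaf of its subtree: a left child is vertically
  below its parent, a right child is shifted by \<open>2 ^ h\<close> to the right, where
  \<open>h\<close> is the height of the child.\<close>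

definition node_pos :: "nat \<times> nat \<Rightarrow> real \<times> real" where
  "node_pos = (\<lambda>(h, i). (real i * 2 ^ h, real h))"

fun edge_arc :: "edge \<Rightarrow> real \<Rightarrow> real \<times> real" where
  "edge_arc (Up h i) = linepath (node_pos (h, i)) (node_pos (Suc h, i div 2))"
| "edge_arc (Hor h i) = linepath (node_pos (h, i)) (node_pos (h, Suc i))"
| "edge_arc (Dang i) = linepath (node_pos (0, i)) (real i, -1)"

lemma node_pos_eq_iff [simp]: "node_pos v = node_pos w \<longleftrightarrow> v = w"
  by (auto simp: node_pos_def split: prod.splits)

lemma inj_node_pos: "inj_on node_pos A"
  by (simp add: inj_on_def)

lemma arc_edge_arc: "arc (edge_arc e)"
  by (cases e) (auto simp: node_pos_def intro!: arc_linepath)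

lemma path_image_edge_arc:
  "z \<in> path_image (edge_arc (Up h i)) \<longleftrightarrow>
     (\<exists>u\<in>{0..1}. z = ((real i - u * real (i mod 2)) * 2 ^ h, real h + u))"
  "z \<in> path_image (edge_arc (Hor h i)) \<longleftrightarrow> (\<exists>u\<in>{0..1}. z = ((real i + u) * 2 ^ h, real h))"
  "z \<in> path_image (edge_arc (Dang i)) \<longleftrightarrow> (\<exists>u\<in>{0..1}. z = (real i, -u))"
proof -
  have "real i = 2 * real (i div 2) + real (i mod 2)"
    by (metis div_mult_mod_eq mult.commute of_nat_add of_nat_mult of_nat_numeral)
  then have *: "(1 - u) * (real i * 2 ^ h) + u * (real (i div 2) * (2 * 2 ^ h)) =
      (real i - u * real (i mod 2)) * 2 ^ h" for u
    by (simp add: algebra_simps)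
  show "z \<in> path_image (edge_arc (Up h i)) \<longleftrightarrow>
     (\<exists>u\<in>{0..1}. z = ((real i - u * real (i mod 2)) * 2 ^ h, real h + u))"
    by (simp add: in_segment node_pos_def * Bex_def) (simp add: algebra_simps)
qed (auto simp: in_segment node_pos_def Bex_def algebra_simps)

text \<open>The coordinates of a point of the drawing that is not a vertex determine its edge, so
  distinct edges meet in vertices only.\<close>

definition edge_at :: "real \<times> real \<Rightarrow> edge" where
  "edge_at = (\<lambda>(x, y).
     if y < 0 then Dang (nat \<lfloor>x\<rfloor>)
     else if y = real (nat \<lfloor>y\<rfloor>) then Hor (nat \<lfloor>y\<rfloor>) (nat \<lfloor>x / 2 ^ nat \<lfloor>y\<rfloor>\<rfloor>)
     else Up (nat \<lfloor>y\<rfloor>) (nat \<lceil>x / 2 ^ nat \<lfloor>y\<rfloor>\<rceil>))"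

lemma edge_point_cases:
  assumes "z \<in> path_image (edge_arc e)"
  shows "z \<in> node_pos ` edge_ends e \<or> z \<notin> range node_pos \<and> edge_at z = e"
proof (cases e)
  case (Up h i)
  obtain u where u: "0 \<le> u" "u \<le> 1"
    and z: "z = ((real i - u * real (i mod 2)) * 2 ^ h, real h + u)"
    using assms unfolding Up path_image_edge_arc by auto
  consider "u = 0" | "u = 1" | "0 < u" "u < 1" using u by linarith
  then show ?thesis
  proof cases
    case 1
    then show ?thesis using z Up by (simp add: node_pos_def)
  next
    case 2
    have "real i = 2 * real (i div 2) + real (i mod 2)"
      by (metis div_mult_mod_eq mult.commute of_nat_add of_nat_mult of_nat_numeral)
    then show ?thesis using 2 z Up by (simp add: node_pos_def)
  next
    case 3
    have fl: "\<lfloor>real h + u\<rfloor> = int h" using 3 by linarith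
    \<comment> \<open>The height of \<open>z\<close> lies strictly between two consecutive
      integers.\<close>
    have "z \<notin> range node_pos"
    proof
      assume "z \<in> range node_pos"
      then obtain j where "real h + u = real j" using z by (auto simp: node_pos_def)
      then have "real h < real j" "real j < real (Suc h)" using 3 by auto
      then show False unfolding of_nat_less_iff by linarith
    qed
    \<comment> \<open>A right child's edge leans left by less than one column before it reaches the
      parent, so rounding up recovers \<open>i\<close>.\<close>
    moreover have "\<lceil>real i - u * real (i mod 2)\<rceil> = int i"
    proof -
      have "i mod 2 = 0 \<or> i mod 2 = 1" by presburger
      then have "0 \<le> u * real (i mod 2)" "u * real (i mod 2) < 1" using 3 by auto
      then show ?thesis by linarith
    qed
    ultimately show ?thesis using 3 z Up fl by (simp add: edge_at_def)
  qed
next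
  case (Hor h i)
  obtain u where u: "0 \<le> u" "u \<le> 1" and z: "z = ((real i + u) * 2 ^ h, real h)"
    using assms unfolding Hor path_image_edge_arc by auto
  consider "u = 0" | "u = 1" | "0 < u" "u < 1" using u by linarith
  then show ?thesis
  proof cases
    case 3
    have "\<lfloor>real i + u\<rfloor> = int i" using 3 by linarith
    moreover have "z \<notin> range node_pos"
    proof
      assume "z \<in> range node_pos"
      then obtain j where "real i + u = real j" using z by (auto simp: node_pos_def)
      then have "real i < real j" "real j < real (Suc i)" using 3 by auto
      then show False unfolding of_nat_less_iff by linarith
    qed
    ultimately show ?thesis using z Hor by (simp add: edge_at_def)
  qed (use z Hor in \<open>auto simp: node_pos_def algebra_simps\<close>)
next
  case (Dang i)
  obtain u where u: "0 \<le> u" "u \<le> 1" and z: "z = (real i, -u)"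
    using assms unfolding Dang path_image_edge_arc by auto
  show ?thesis
  proof (cases "u = 0")
    case False
    then show ?thesis using u z Dang by (auto simp: edge_at_def node_pos_def)
  qed (use z Dang in \<open>auto simp: node_pos_def\<close>)
qed

lemma edge_ends_subset_path_image:
  "node_pos ` edge_ends e \<subseteq> path_image (edge_arc e)"
  by (cases e) auto

lemma plane_drawing_net:
  assumes "is_gadget (net m k f)"
  shows "plane_drawing (net m k f) node_pos edge_arc"
proof -
  have sub: "edge_ends e \<subseteq> net_verts m" if "e \<in> net_edges m \<union> set (dangling (net m k f))" for e
    using assms that unfolding is_gadget_def by fastforce
  have "path_image (edge_arc e) \<inter> node_pos ` net_verts m = node_pos ` edge_ends e"
    if "e \<in> net_edges m \<union> set (dangling (net m k f))" for e
  proof (intro equalityI subsetI)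
    fix z assume "z \<in> path_image (edge_arc e) \<inter> node_pos ` net_verts m"
    then show "z \<in> node_pos ` edge_ends e" using edge_point_cases[of z e] by auto
  next
    fix z assume "z \<in> node_pos ` edge_ends e"
    then show "z \<in> path_image (edge_arc e) \<inter> node_pos ` net_verts m"
      using edge_ends_subset_path_image[of e] sub[OF that] by auto
  qed
  moreover have "path_image (edge_arc e) \<inter> path_image (edge_arc e') \<subseteq>
      node_pos ` (edge_ends e \<inter> edge_ends e')" if "e \<noteq> e'" for e e'
    unfolding image_Int[OF inj_node_pos]
  proof
    fix z assume z: "z \<in> path_image (edge_arc e) \<inter> path_image (edge_arc e')"
    have "z \<in> node_pos ` edge_ends e \<or> z \<notin> range node_pos \<and> edge_at z = e"
      using z by (intro edge_point_cases) simp
    moreover have "z \<in> node_pos ` edge_ends e' \<or> z \<notin> range node_pos \<and> edge_at z = e'"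
      using z by (intro edge_point_cases) simp
    ultimately show "z \<in> node_pos ` edge_ends e \<inter> node_pos ` edge_ends e'"
      \<comment> \<open>If \<open>z\<close> is no vertex point, \<open>edge_at z\<close> would equal
        both \<open>e\<close> and \<open>e'\<close>; if it is one, it must be an end of
        each.\<close>
      using that by (metis IntI rangeI imageE)
  qed
  moreover have "{pathstart (edge_arc e), pathfinish (edge_arc e)} = node_pos ` edge_ends e"
    if "e \<in> net_edges m" for e
    using that by (cases e) auto
  moreover have "{pathstart (edge_arc x)} = node_pos ` edge_ends x"
    if "x \<in> set (dangling (net m k f))" for x
    using that by auto
  ultimately show ?thesis
    unfolding plane_drawing_def net_simps(1,2,4) by (intro conjI ballI impI arc_edge_arc inj_node_pos)
qed

text \<open>Vertices and ordinary edges lie in the closed upper half-plane. It is convex, so its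
  complement, which contains the dangling edges without their vertices, lies in the outer
  face.\<close>

lemma planar_net:
  assumes "is_gadget (net m k f)"
  shows "planar_gadget (net m k f)"
proof -
  let ?H = "{z :: real \<times> real. 0 \<le> snd z}"
  have "drawn_points (net m k f) node_pos edge_arc \<subseteq> ?H"
  proof -
    have "path_image (edge_arc e) \<subseteq> ?H" if "e \<in> net_edges m" for e
      using that by (cases e) (auto simp: path_image_edge_arc simp del: edge_arc.simps)
    then show ?thesis by (force simp: drawn_points_def node_pos_def)
  qed
  moreover have "convex ?H"
    by (auto simp: convex_def)
  ultimately have "- ?H \<subseteq> outside (drawn_points (net m k f) node_pos edge_arc)"
    by (intro outside_subset_convex)
  moreover have "path_image (edge_arc (Dang i)) - node_pos ` edge_ends (Dang i) \<subseteq> - ?H" for i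
    by (auto simp: path_image_edge_arc node_pos_def simp del: edge_arc.simps)
  ultimately have "\<forall>x\<in>set (dangling (net m k f)). path_image (edge_arc x) - node_pos ` edge_ends x
      \<subseteq> outside (drawn_points (net m k f) node_pos edge_arc)"
    unfolding net_simps set_map by blast
  then show ?thesis
    using assms plane_drawing_net[OF assms] unfolding planar_gadget_def net_simps(4) by blast
qed

section \<open>The run of the circuit on a given input and its uniqueness\<close>

section \<open>The signature of the network\<close>

text \<open>Past the end of \<open>ys\<close> the count stays constant, matching the input leaves
  without a dangling edge, which are forced to 0.\<close>

definition prefix_count :: "bool list \<Rightarrow> nat \<Rightarrow> nat" where
  "prefix_count ys t = count_list (take t ys) True"

text \<open>The number of ones that arrive at the first \<open>i\<close> adder inputs of significance \<open>2 ^ h\<close>.\<close>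

definition carry_count :: "bool list \<Rightarrow> nat \<Rightarrow> nat \<Rightarrow> nat" where
  "carry_count ys h i = prefix_count ys (i * 2 ^ h) div 2 ^ h"

text \<open>Closed form of all signals. An adder emits a carry exactly when its carry count grows. A
  demultiplexer at height \<open>h\<close> is enabled iff its number within the right half is the
  total count divided by \<open>2 ^ h\<close>. The formula for \<open>Hor\<close> covers both
  halves: right of the adders the prefix contains all inputs, and the parity is the finished
  digit.\<close>

fun run :: "nat \<Rightarrow> bool list \<Rightarrow> edge \<Rightarrow> bool" where
  "run m ys (Up h i) =
     (if i < 2 ^ (m - h) then carry_count ys h (Suc i) \<noteq> carry_count ys h i
      else prefix_count ys (2 ^ m) div 2 ^ h = i - 2 ^ (m - h))"
| "run m ys (Hor h i) = odd (carry_count ys (h - 1) (2 * Suc i))"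
| "run m ys (Dang i) = ys ! i"

lemma prefix_count_Suc:
  "prefix_count ys (Suc t) = prefix_count ys t + of_bool (t < length ys \<and> ys ! t)"
  by (cases "t < length ys") (simp_all add: prefix_count_def take_Suc_conv_app_nth)

lemma prefix_count_add:
  "prefix_count ys t \<le> prefix_count ys (t + d)" "prefix_count ys (t + d) \<le> prefix_count ys t + d"
  by (induction d) (auto simp: prefix_count_Suc)

lemma prefix_count_ge: "length ys \<le> t \<Longrightarrow> prefix_count ys t = count_list ys True"
  by (simp add: prefix_count_def)

lemma prefix_count_0 [simp]: "prefix_count ys 0 = 0"
  by (simp add: prefix_count_def)

lemma carry_count_0 [simp]: "carry_count ys h 0 = 0"
  by (simp add: carry_count_def)

text \<open>Two successive floor divisions are one; this is how a row halves the arrivals of the row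
  below.\<close>

lemma carry_count_Suc_height: "carry_count ys (Suc h) i = carry_count ys h (2 * i) div 2"
  by (simp only: carry_count_def power_Suc ac_simps flip: div_mult2_eq)

text \<open>A block of \<open>2 ^ h\<close> further inputs adds between 0 and \<open>2 ^ h\<close>
  ones, so the quotient grows by at most 1 and one bit can carry the growth.\<close>

lemma carry_count_Suc:
  "carry_count ys h (Suc i) = carry_count ys h i \<or> carry_count ys h (Suc i) = Suc (carry_count ys h i)"
proof -
  let ?p = "prefix_count ys (i * 2 ^ h)" and ?q = "prefix_count ys (i * 2 ^ h + 2 ^ h)"
  have "?p div 2 ^ h \<le> ?q div 2 ^ h" "?q div 2 ^ h \<le> (?p + 2 ^ h) div 2 ^ h"
    by (intro div_le_mono prefix_count_add)+
  then show ?thesis by (auto simp: carry_count_def add.commute)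
qed

lemma carry_count_right:
  assumes "length ys \<le> 2 ^ m" and "h \<le> m" and "2 ^ (m - h) \<le> i"
  shows "carry_count ys h i = count_list ys True div 2 ^ h"
proof -
  have "(2::nat) ^ m = 2 ^ (m - h) * 2 ^ h" using assms(2) by (simp flip: power_add)
  then have "2 ^ m \<le> i * 2 ^ h" using assms(3) by simp
  then show ?thesis using assms(1) by (simp add: carry_count_def prefix_count_ge)
qed

lemma node_ok_run:
  assumes "length ys = k" "k < 2 ^ m" "v \<in> net_verts m"
  shows "node_ok m k v (run m ys)"
proof -
  obtain h i where v: "v = (h, i)" by fastforce
  have hi: "h \<le> Suc m" "i < 2 ^ (Suc m - h)" using assms(3) v by auto
  let ?w = "count_list ys True"
  have w: "prefix_count ys (2 ^ m) = ?w" using assms by (simp add: prefix_count_ge)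
  have wm: "?w < 2 ^ m" using count_le_length[of ys True] assms by linarith
  consider "h = 0" | "h = Suc m" | g where "h = Suc g" "g < m"
    using hi by (cases h) force+
  then show ?thesis
  proof cases
    case 1
    then show ?thesis using v assms
      by (auto simp: node_ok_def carry_count_def prefix_count_Suc)
  next
    case 2
    \<comment> \<open>Since the count is below \<open>2 ^ m\<close>, its quotient by
      \<open>2 ^ m\<close> is 0: there is no final carry, and the topmost demultiplexer has number
      0.\<close>
    then show ?thesis using v w wm by (simp add: node_ok_def carry_count_def)
  next
    case 3
    define n :: nat where "n = 2 ^ (m - h)"
    have "m - g = Suc (m - h)" "Suc m - h = Suc (m - h)" using 3 by auto
    then have p: "2 ^ (m - g) = 2 * n" "2 ^ (Suc m - h) = 2 * n" "n > 0"
      by (simp_all add: n_def)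
    let ?c = "carry_count ys g"
    \<comment> \<open>For \<open>i = 0\<close> the missing neighbour matches the even count
      0.\<close>
    have l: "(0 < i \<and> run m ys (Hor h (i - 1))) = odd (?c (2 * i))"
      using 3 by (cases i) auto
    show ?thesis
    proof (cases "i < n")
      case True
      \<comment> \<open>\<open>A\<close>, \<open>B\<close>, \<open>C\<close> are the arrivals before
        the two inputs of the adder, between them and after them. The identity is
        \<open>A mod 2 + (C - A) = C mod 2 + 2 * (C div 2 - A div 2)\<close>.\<close>
      have "of_bool (odd A) + of_bool (B \<noteq> A) + of_bool (C \<noteq> B) =
          (of_bool (odd C) + 2 * of_bool (C div 2 \<noteq> A div 2) :: nat)"
        if "B = A \<or> B = Suc A" "C = B \<or> C = Suc B" for A B C :: nat
        using that by (cases "even A") (auto elim!: evenE oddE, presburger)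
      from this[OF carry_count_Suc carry_count_Suc]
      have "of_bool (odd (?c (2 * i))) + of_bool (?c (Suc (2 * i)) \<noteq> ?c (2 * i)) +
          of_bool (?c (Suc (Suc (2 * i))) \<noteq> ?c (Suc (2 * i))) =
          (of_bool (odd (?c (Suc (Suc (2 * i))))) +
           2 * of_bool (?c (Suc (Suc (2 * i))) div 2 \<noteq> ?c (2 * i) div 2) :: nat)" .
      then show ?thesis using v 3 True l
        by (simp add: node_ok_def Let_def p carry_count_Suc_height n_def)
    next
      case False
      have "?c j = ?w div 2 ^ g" if "2 * n \<le> j" for j
        by (rule carry_count_right[of _ m]) (use assms 3 p that in auto)
      then have c: "?c (2 * i) = ?w div 2 ^ g" "?c (2 * Suc i) = ?w div 2 ^ g"
        using False by auto
      define q where "q = ?w div 2 ^ g"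
      have q2: "?w div 2 ^ h = q div 2" using 3 by (simp add: q_def mult.commute flip: div_mult2_eq)
      \<comment> \<open>As \<open>n \<le> i\<close>, the truncated differences are genuine. Going
        down one row, the number of the enabled node doubles and takes the digit
        \<open>q mod 2\<close> as its last bit.\<close>
      have parity: "(q = 2 * i - 2 * n) = (q div 2 = i - n \<and> even q)"
        "(q = Suc (2 * i) - 2 * n) = (q div 2 = i - n \<and> odd q)"
        using False by presburger+
      have "0 < i" using False p(3) by simp
      then have "run m ys (Hor h (i - 1)) = odd q" using l c(1) by (simp add: q_def)
      moreover have "run m ys (Hor h i) = odd q" using c(2) 3 by (simp add: q_def)
      moreover have "run m ys (Up h i) = (q div 2 = i - n)" using False w q2 by (simp flip: n_def)
      moreover have "run m ys (Up g (2 * i)) = (q div 2 = i - n \<and> even q)"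
        "run m ys (Up g (Suc (2 * i))) = (q div 2 = i - n \<and> odd q)"
        using False by (simp_all add: p(1) w flip: q_def parity)
      ultimately show ?thesis using v 3 False[unfolded n_def] \<open>0 < i\<close>
        by (simp add: node_ok_def Let_def del: run.simps)
    qed
  qed
qed

lemma full_adder_unique:
  assumes "s = (of_bool r + 2 * of_bool u :: nat)" "s = of_bool r' + 2 * of_bool u'"
  shows "r = r' \<and> u = u'"
  using assms by (cases r; cases u; cases r'; cases u') auto

text \<open>The signals are determined in order of evaluation: adders from the bottom up, then
  digits along the demultiplexers, then enabling signals from the root down.\<close>

lemma node_ok_unique:
  assumes a: "\<And>v. v \<in> net_verts m \<Longrightarrow> node_ok m k v a"
    and b: "\<And>v. v \<in> net_verts m \<Longrightarrow> node_ok m k v b"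
    and dang: "\<And>i. i < k \<Longrightarrow> a (Dang i) = b (Dang i)"
    and e: "e \<in> net_edges m"
  shows "a e = b e"
proof -
  have pow: "(2::nat) ^ (m - g) = 2 * 2 ^ (m - Suc g)" "(2::nat) ^ (Suc m - g) = 4 * 2 ^ (m - Suc g)"
    if "g < m" for g
  proof -
    have "m - g = Suc (m - Suc g)" "Suc m - g = Suc (Suc (m - Suc g))" using that by auto
    then show "(2::nat) ^ (m - g) = 2 * 2 ^ (m - Suc g)"
      "(2::nat) ^ (Suc m - g) = 4 * 2 ^ (m - Suc g)" by simp_all
  qed
  have adder: "of_bool (0 < i \<and> x (Hor (Suc g) (i - 1))) + of_bool (x (Up g (2 * i))) +
        of_bool (x (Up g (Suc (2 * i)))) =
        (of_bool (x (Hor (Suc g) i)) + 2 * of_bool (x (Up (Suc g) i)) :: nat)"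
    if "\<And>v. v \<in> net_verts m \<Longrightarrow> node_ok m k v x" "g < m" "i < 2 ^ (m - Suc g)" for x g i
    using that(1)[of "(Suc g, i)"] that(2,3) pow(1)[OF that(2)] by (simp add: node_ok_def Let_def)
  have demux: "(Suc i < 2 * 2 ^ (m - Suc g) \<longrightarrow> x (Hor (Suc g) i) = x (Hor (Suc g) (i - 1))) \<and>
        x (Up g (2 * i)) = (x (Up (Suc g) i) \<and> \<not> x (Hor (Suc g) (i - 1))) \<and>
        x (Up g (Suc (2 * i))) = (x (Up (Suc g) i) \<and> x (Hor (Suc g) (i - 1)))"
    if "\<And>v. v \<in> net_verts m \<Longrightarrow> node_ok m k v x" "g < m" "2 ^ (m - Suc g) \<le> i"
      "i < 2 * 2 ^ (m - Suc g)" for x g i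
  proof -
    have "0 < i" using that(3) by (metis gr0I less_le_trans pos2 zero_less_power less_irrefl)
    then show ?thesis
      using that(1)[of "(Suc g, i)"] that(2-4) pow(1)[OF that(2)] by (simp add: node_ok_def Let_def)
  qed
  \<comment> \<open>Induction on the rows, with an inner induction from left to right along each
    row.\<close>
  have left: "a (Up g i) = b (Up g i) \<and> (0 < g \<longrightarrow> a (Hor g i) = b (Hor g i))"
    if "g \<le> m" "i < 2 ^ (m - g)" for g i
    using that
  proof (induction g arbitrary: i)
    case 0
    then show ?case using a[of "(0, i)"] b[of "(0, i)"] dang[of i] by (auto simp: node_ok_def)
  next
    case (Suc g)
    have IH: "a (Up g j) = b (Up g j)" if "j < 2 * 2 ^ (m - Suc g)" for j
      using Suc.IH[of j] Suc.prems(1) that pow[of g] by auto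
    have row: "a (Hor (Suc g) i) = b (Hor (Suc g) i) \<and> a (Up (Suc g) i) = b (Up (Suc g) i)"
      if i: "i < 2 ^ (m - Suc g)" and l: "0 < i \<longrightarrow> a (Hor (Suc g) (i - 1)) = b (Hor (Suc g) (i - 1))"
      for i
    proof (rule full_adder_unique)
      have g: "g < m" using Suc.prems(1) by simp
      show "of_bool (0 < i \<and> a (Hor (Suc g) (i - 1))) + of_bool (a (Up g (2 * i))) +
          of_bool (a (Up g (Suc (2 * i)))) =
          (of_bool (a (Hor (Suc g) i)) + 2 * of_bool (a (Up (Suc g) i)) :: nat)"
        by (rule adder[OF a g i])
      show "of_bool (0 < i \<and> a (Hor (Suc g) (i - 1))) + of_bool (a (Up g (2 * i))) +
          of_bool (a (Up g (Suc (2 * i)))) =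
          (of_bool (b (Hor (Suc g) i)) + 2 * of_bool (b (Up (Suc g) i)) :: nat)"
      proof -
        have "(0 < i \<and> a (Hor (Suc g) (i - 1))) = (0 < i \<and> b (Hor (Suc g) (i - 1)))"
          using l by blast
        moreover have "a (Up g (2 * i)) = b (Up g (2 * i))"
          "a (Up g (Suc (2 * i))) = b (Up g (Suc (2 * i)))"
          using i by (simp_all add: IH)
        ultimately show ?thesis using adder[OF b g i] by (simp only:)
      qed
    qed
    have hor: "a (Hor (Suc g) i) = b (Hor (Suc g) i)" if "i < 2 ^ (m - Suc g)" for i
      using that
    proof (induction i)
      case 0
      then show ?case using row[of 0] by simp
    next
      case (Suc i)
      then show ?case using row[of "Suc i"] by simp
    qed
    have "i - 1 < 2 ^ (m - Suc g)" using Suc.prems(2) by simp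
    then show ?case using row[OF Suc.prems(2)] hor[of "i - 1"] by simp
  qed
  \<comment> \<open>Demultiplexers copy the digit from their left neighbour, starting from the last
    adder.\<close>
  have hor: "a (Hor (Suc g) i) = b (Hor (Suc g) i)" if "g < m" "Suc i < 2 * 2 ^ (m - Suc g)" for g i
    using that(2)
  proof (induction i)
    case 0
    show ?case using left[of "Suc g" 0] that(1) by auto
  next
    case (Suc i)
    show ?case
    proof (cases "Suc i < 2 ^ (m - Suc g)")
      case True
      then show ?thesis using left[of "Suc g" "Suc i"] that(1) by auto
    next
      case False
      then show ?thesis
        using demux[OF a that(1), of "Suc i"] demux[OF b that(1), of "Suc i"] Suc by auto
    qed
  qed
  \<comment> \<open>Downward induction from the root, which fixes both edges below it. In the right
    half the parent's enabling signal and the digit reaching the parent fix the edge.\<close>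
  have up: "a (Up g i) = b (Up g i)" if "g \<le> m" "i < 2 ^ (Suc m - g)" for g i
    using that
  proof (induction g arbitrary: i rule: inc_induct)
    case base
    then have "i = 0 \<or> i = 1" by auto
    then show ?case using a[of "(Suc m, 0)"] b[of "(Suc m, 0)"] by (auto simp: node_ok_def)
  next
    case (step g)
    show ?case
    proof (cases "i < 2 ^ (m - g)")
      case True
      then show ?thesis using left step.hyps by auto
    next
      case False
      define j where "j = i div 2"
      have j: "i = 2 * j \<or> i = Suc (2 * j)" unfolding j_def by presburger
      then have jn: "2 ^ (m - Suc g) \<le> j" "j < 2 * 2 ^ (m - Suc g)"
        using False step.prems step.hyps pow[of g] by auto
      have "a (Up (Suc g) j) = b (Up (Suc g) j)"
        using step.IH[of j] jn(2) step.hyps pow(1)[of g] by simp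
      moreover have "0 < j" using jn(1) by (metis gr0I less_le_trans pos2 zero_less_power less_irrefl)
      then have "a (Hor (Suc g) (j - 1)) = b (Hor (Suc g) (j - 1))"
        using hor[of g "j - 1"] jn(2) step.hyps by auto
      ultimately show ?thesis
        using demux[OF a _ jn] demux[OF b _ jn] step.hyps j by auto
    qed
  qed
  show ?thesis
  proof (cases e)
    case (Hor h i)
    then obtain g where "h = Suc g" "g < m" "Suc i < 2 ^ (Suc m - h)"
      using e by (cases h) auto
    then show ?thesis using Hor hor[of g i] pow(1)[of g] by simp
  qed (use up e in auto)
qed

lemma signature_net:
  assumes "length ys = k" "k < 2 ^ m" "\<And>j. algebraic (f j)"
  shows "signature (net m k f) ys = f (count_list ys True)"
proof -
  let ?w = "count_list ys True"
  have w: "prefix_count ys (2 ^ m) = ?w" using assms by (simp add: prefix_count_ge)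
  have wm: "?w < 2 ^ m" using count_le_length[of ys True] assms by linarith
  have "signature (net m k f) ys = (\<Prod>v\<in>verts (net m k f). node_weight m f v (run m ys))"
  proof (rule signature_unique_assignment)
    show "is_gadget (net m k f)" using assms by (intro is_gadget_net) auto
    show "vfun (net m k f) v (map a (nbr_order (net m k f) v)) =
        (if node_ok m k v a then node_weight m f v a else 0)" if "v \<in> verts (net m k f)" for v a
      using net_vfun_map[of v m k f a] that assms(2) by (simp add: node_fun_def)
    show "node_ok m k v (run m ys)" if "v \<in> verts (net m k f)" for v
      using node_ok_run assms that by simp
    show "\<forall>e\<in>edges (net m k f). a e = run m ys e"
      if "\<And>v. v \<in> verts (net m k f) \<Longrightarrow> node_ok m k v a"
        "\<And>x. x \<in> set (dangling (net m k f)) \<Longrightarrow> a x = run m ys x" for a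
      using node_ok_unique[of m k a "run m ys"] node_ok_run[OF assms(1,2)] that by simp
    show "ys = map (run m ys) (dangling (net m k f))"
      using assms(1) by (auto intro: nth_equalityI)
  qed
  also have "\<dots> = (\<Prod>v\<in>net_verts m. if v = (0, 2 ^ m + ?w) then f ?w else 1)"
    unfolding net_simps
  proof (rule prod.cong[OF refl])
    fix v :: "nat \<times> nat"
    obtain h i where "v = (h, i)" by fastforce
    then show "node_weight m f v (run m ys) = (if v = (0, 2 ^ m + ?w) then f ?w else 1)"
      \<comment> \<open>In row 0 the run enables the output leaf numbered \<open>?w\<close> and no
        other; every other vertex has weight 1.\<close>
      using w by (cases "h = 0"; cases "2 ^ m \<le> i") (auto simp: node_weight_def)
  qed
  also have "\<dots> = f ?w"
    \<comment> \<open>The bound on \<open>?w\<close> ensures that this leaf exists.\<close>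
    using wm by (subst prod.delta) auto
  finally show ?thesis .
qed

section \<open>Symmetric functions and the choice of parameters\<close>

text \<open>Equal length and equally many ones give equal multisets of bits, hence a permutation
  between the lists.\<close>

lemma symmetric_fun_count:
  assumes "symmetric_fun k F" "length xs = k" "length ys = k"
    and "count_list xs True = count_list ys True"
  shows "F xs = F ys"
proof -
  have "count_list zs False = length zs - count_list zs True \<and> count_list zs True \<le> length zs"
    for zs by (induction zs) auto
  then have "mset xs = mset ys" using assms
    by (intro multiset_eqI) (metis (full_types) count_mset)
  then obtain p where "p permutes {..<length ys}" "permute_list p ys = xs"
    by (rule mset_eq_permutation)
  then show ?thesis using assms unfolding symmetric_fun_def by metis
qed

theorem mainTheorem3:
  shows "\<exists>C :: real. \<forall>k :: nat. \<forall>F :: bool list \<Rightarrow> complex.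
    k > 0 \<longrightarrow> algebraic_valued k F \<longrightarrow> symmetric_fun k F \<longrightarrow>
    (\<exists>G :: (nat, nat) gadget.
       planar_gadget G \<and> has_signature G k F \<and>
       real (card (verts G)) \<le> C * real k \<and>
       (\<forall>v \<in> verts G. degree_at G v \<le> 5))"
\<comment> \<open>There are fewer than \<open>4 * 2 ^ m\<close> vertices, and
  \<open>2 ^ m = 2 * 2 ^ n \<le> 2 * k\<close>.\<close>
proof (intro exI[of _ 8] allI impI)
  fix k :: nat and F :: "bool list \<Rightarrow> complex"
  assume k: "k > 0" and alg: "algebraic_valued k F" and sym: "symmetric_fun k F"
  have count: "count_list (replicate j True) True = j" for j
    by (induction j) auto
  obtain n where n: "2 ^ n \<le> k" "k < 2 ^ (n + 1)"
    using ex_power_ivl1[of 2 k] k by auto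
  \<comment> \<open>This makes \<open>k < 2 ^ m\<close> strict, so that the weight \<open>k\<close>
    also has its output leaf.\<close>
  define m where "m = Suc n"
  \<comment> \<open>The value of \<open>F\<close> on weight \<open>j\<close>, read off a sorted
    input; leaves numbered above \<open>k\<close> get the default 0.\<close>
  define f where
    "f j = (if j \<le> k then F (replicate j True @ replicate (k - j) False) else 0)" for j
  let ?G = "relabel (net m k f)"
  have km: "k < 2 ^ m" using n by (simp add: m_def)
  have f: "algebraic (f j)" for j using alg by (auto simp: f_def algebraic_valued_def)
  have "planar_gadget ?G"
    using km f by (intro planar_relabel planar_net is_gadget_net) auto
  moreover have "has_signature ?G k F"
  proof -
    have "signature ?G ys = F ys" if "length ys = k" for ys
    proof -
      let ?w = "count_list ys True"
      have w: "?w \<le> k" using count_le_length[of ys True] that by simp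
      have "signature ?G ys = f ?w"
        using signature_net[OF that km f] by (simp add: signature_relabel)
      also have "\<dots> = F ys"
        unfolding f_def using w that by (auto intro!: symmetric_fun_count[OF sym] simp: count)
      finally show ?thesis .
    qed
    then show ?thesis by (simp add: has_signature_def)
  qed
  moreover have "real (card (verts ?G)) \<le> 8 * real k"
  proof -
    have "card (verts ?G) = card (net_verts m)" by (simp add: card_image)
    then show ?thesis using card_net_verts[of m] n(1) unfolding m_def by simp
  qed
  moreover have "\<forall>v\<in>verts ?G. degree_at ?G v \<le> 5"
    by (auto simp: degree_net)
  ultimately show "\<exists>G :: (nat, nat) gadget.
       planar_gadget G \<and> has_signature G k F \<and>
       real (card (verts G)) \<le> 8 * real k \<and>
       (\<forall>v \<in> verts G. degree_at G v \<le> 5)"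
    by blast
qed

end
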